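(* Let $\mathbf w=(w_m)_{m\in\mathcal M}$ be fixed positive weights with $M^{-1}\sum_{m\in\mathcal M}w_m=1$, let $\alpha\in(0,1)$ and $\lambda\in(0,1)$, and let $w_{(M)}=\max_m w_m$. Suppose that $M_0\ge1$, that the decision functions satisfy the NS assumptions, that $u=\lambda\le 1/w_{(M)}$, and that $(Z_m)_{m\in\mathcal M_0}$ are mutually independent and independent of $(Z_m)_{m\in\mathcal M_1}$. If $$\alpha^*=\alpha\,\frac{1}{w_{(M)}}\,\frac{1-\lambda w_{(M)}}{1-\lambda},$$ then $FDR(\hat t_{\alpha^*}^\lambda\mathbf w)\le\alpha$.
   Context: $\mathcal M=\{1,\dots,M\}$; $\mathbf Z=(Z_m)_{m\in\mathcal M}$ is a random vector of test statistics used to test null hypotheses $H_m$, $m\in\mathcal M$. $\mathcal M_0$ is the (deterministic) set of indices $m$ for which $H_m$ is true, $\mathcal M_1=\mathcal M\setminus\mathcal M_0$, $M_0=|\mathcal M_0|$. Decision functions: $\delta_m(t_m)=\delta_m(Z_m;t_m)\in\{0,1\}$ (1 means reject $H_m$), with $t_m\in[0,1]$. NS assumptions: for each $m$, $t_m\mapsto\delta_m(Z_m;t_m)$ is almost surely nondecreasing and right continuous with $\delta_m=0$ at $t_m=0$ and $\delta_m=1$ at $t_m=1$; $t_m\mapsto E[\delta_m(Z_m;t_m)]$ is continuous and strictly increasing on $(0,1)$; and $E[\delta_m(Z_m;t_m)]=t_m$ for $m\in\mathcal M_0$. For $t\in[0,u]$: $R(t\mathbf w)=\sum_{m\in\mathcal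 M}\delta_m(tw_m)$, $V(t\mathbf w)=\sum_{m\in\mathcal M_0}\delta_m(tw_m)$, $FDP(t\mathbf w)=V(t\mathbf w)/\max\{R(t\mathbf w),1\}$. Further $$\hat M_0(\lambda\mathbf w)=\frac{M-R(\lambda\mathbf w)+1}{1-\lambda},\qquad \widehat{FDP}^\lambda(t\mathbf w)=\frac{\hat M_0(\lambda\mathbf w)\,t}{\max\{R(t\mathbf w),1\}},$$ and, for a level $a\ge 0$, $\hat t_a^\lambda=\sup\{0\le t\le u:\widehat{FDP}^\lambda(t\mathbf w)\le a\}$. $FDR(\hat t_a^\lambda\mathbf w)=E[FDP(\hat t_a^\lambda\mathbf w)]$, the expectation being over $\mathbf Z$. *)

theory Defs
  imports "HOL-Probability.Probability"
begin

text \<open>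
  The argument \<open>d\<close> below is one realisation of the family of decision functions:
  \<open>d m t\<close> stands for \<open>\<delta> m (Z m \<omega>) t\<close>, with value 1 for rejection and 0 otherwise.
  The hypotheses are indexed by \<open>{1..M}\<close>, and \<open>T\<close> is the set of indices of the true
  nulls. So \<open>num_rej {1..M}\<close> is the number of rejections and \<open>num_rej T\<close> the number of false ones.
\<close>

definition num_rej :: "nat set \<Rightarrow> (nat \<Rightarrow> real) \<Rightarrow> (nat \<Rightarrow> real \<Rightarrow> real) \<Rightarrow> real \<Rightarrow> real" where
  "num_rej A w d t = (\<Sum>m\<in>A. d m (t * w m))"

definition FDP :: "nat \<Rightarrow> nat set \<Rightarrow> (nat \<Rightarrow> real) \<Rightarrow> (nat \<Rightarrow> real \<Rightarrow> real) \<Rightarrow> real \<Rightarrow> real" where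
  "FDP M T w d t = num_rej T w d t / max (num_rej {1..M} w d t) 1"

definition M0_hat :: "nat \<Rightarrow> (nat \<Rightarrow> real) \<Rightarrow> (nat \<Rightarrow> real \<Rightarrow> real) \<Rightarrow> real \<Rightarrow> real" where
  "M0_hat M w d l = (real M - num_rej {1..M} w d l + 1) / (1 - l)"

definition FDP_hat ::
    "nat \<Rightarrow> (nat \<Rightarrow> real) \<Rightarrow> (nat \<Rightarrow> real \<Rightarrow> real) \<Rightarrow> real \<Rightarrow> real \<Rightarrow> real" where
  "FDP_hat M w d l t = M0_hat M w d l * t / max (num_rej {1..M} w d t) 1"

text \<open>For \<open>a \<ge> 0\<close> and \<open>u \<ge> 0\<close> the set contains 0 and is bounded by \<open>u\<close>.\<close>

definition t_hat ::
    "nat \<Rightarrow> (nat \<Rightarrow> real) \<Rightarrow> (nat \<Rightarrow> real \<Rightarrow> real) \<Rightarrow> real \<Rightarrow> real \<Rightarrow> real \<Rightarrow> real" where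
  "t_hat M w d u l a = Sup {t. 0 \<le> t \<and> t \<le> u \<and> FDP_hat M w d l t \<le> a}"

definition FDP_at_t_hat ::
    "nat \<Rightarrow> nat set \<Rightarrow> (nat \<Rightarrow> 'a \<Rightarrow> 'z) \<Rightarrow> (nat \<Rightarrow> 'z \<Rightarrow> real \<Rightarrow> real) \<Rightarrow>
     (nat \<Rightarrow> real) \<Rightarrow> real \<Rightarrow> real \<Rightarrow> real \<Rightarrow> 'a \<Rightarrow> real" where
  "FDP_at_t_hat M T Z \<delta> w u l a \<omega> =
     (let d = (\<lambda>m. \<delta> m (Z m \<omega>)) in FDP M T w d (t_hat M w d u l a))"

text \<open>
  Since the paths of the decision functions are regular only almost surely, the FDP at the
  data-dependent threshold agrees with a measurable function only outside a null set. The
  expectation is therefore taken over the completion, which leaves the expectation of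
  every measurable function unchanged.
\<close>

definition FDR ::
    "'a measure \<Rightarrow> nat \<Rightarrow> nat set \<Rightarrow> (nat \<Rightarrow> 'a \<Rightarrow> 'z) \<Rightarrow> (nat \<Rightarrow> 'z \<Rightarrow> real \<Rightarrow> real) \<Rightarrow>
     (nat \<Rightarrow> real) \<Rightarrow> real \<Rightarrow> real \<Rightarrow> real \<Rightarrow> real" where
  "FDR P M T Z \<delta> w u l a = (\<integral>\<omega>. FDP_at_t_hat M T Z \<delta> w u l a \<omega> \<partial>completion P)"

definition decision_functions ::
    "nat \<Rightarrow> (nat \<Rightarrow> 'z measure) \<Rightarrow> (nat \<Rightarrow> 'z \<Rightarrow> real \<Rightarrow> real) \<Rightarrow> bool" where
  "decision_functions M N \<delta> \<longleftrightarrow>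
     (\<forall>m\<in>{1..M}. \<forall>t\<in>{0..1}.
        (\<lambda>z. \<delta> m z t) \<in> borel_measurable (N m) \<and>
        (\<forall>z\<in>space (N m). \<delta> m z t \<in> {0, 1}))"

definition NS_assumptions ::
    "'a measure \<Rightarrow> nat \<Rightarrow> nat set \<Rightarrow> (nat \<Rightarrow> 'a \<Rightarrow> 'z) \<Rightarrow> (nat \<Rightarrow> 'z \<Rightarrow> real \<Rightarrow> real) \<Rightarrow> bool" where
  "NS_assumptions P M T Z \<delta> \<longleftrightarrow>
     (\<forall>m\<in>{1..M}.
        (AE \<omega> in P. mono_on {0..1} (\<delta> m (Z m \<omega>)) \<and>
           (\<forall>t\<in>{0..<1}. continuous (at_right t) (\<delta> m (Z m \<omega>))) \<and>
           \<delta> m (Z m \<omega>) 0 = 0 \<and> \<delta> m (Z m \<omega>) 1 = 1) \<and>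
        continuous_on {0<..<1} (\<lambda>t. \<integral>\<omega>. \<delta> m (Z m \<omega>) t \<partial>P) \<and>
        strict_mono_on {0<..<1} (\<lambda>t. \<integral>\<omega>. \<delta> m (Z m \<omega>) t \<partial>P)) \<and>
     (\<forall>m\<in>T. \<forall>t\<in>{0..1}. (\<integral>\<omega>. \<delta> m (Z m \<omega>) t \<partial>P) = t)"

end

theory Submission
  imports Defs
begin

text \<open>
  Let \<open>Q m = p m / w m\<close> be the weighted p-values, so that \<open>R t\<close> counts the \<open>m\<close> with \<open>Q m \<le> t\<close>, and
  \<open>Q m\<close> has distribution function \<open>t \<mapsto> w m * t\<close> on \<open>[0, \<lambda>]\<close> for true nulls. For a true null \<open>m\<close>
  let a prime denote replacing \<open>Q m\<close> by 0. If \<open>Q m \<le> t_hat\<close>, this does not change \<open>t_hat\<close>. Since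
  \<open>t_hat'\<close> is independent of \<open>Q m\<close>, the contribution of \<open>m\<close> to the FDR is at most
  \<open>w m * E (t_hat' / max (R' t_hat') 1) \<le> w m * c * E (1 / (M - R' \<lambda> + 1))\<close> with \<open>c = \<alpha>' * (1 - \<lambda>)\<close>.
  As \<open>w m * c \<le> \<alpha> * (1 - w m * \<lambda>)\<close>, independence used backwards with \<open>P (Q m > \<lambda>) = 1 - w m * \<lambda>\<close>
  bounds this by \<open>\<alpha> * E (1{Q m > \<lambda>} / (M - R \<lambda>))\<close>, because \<open>R' \<lambda> = R \<lambda> + 1\<close> if \<open>Q m > \<lambda>\<close>.
  The indicators sum to at most \<open>M - R \<lambda>\<close>. No martingale argument is needed.
\<close>

section \<open>Rejection counts and the step-up threshold of weighted p-values\<close>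

definition count_le :: "'i set \<Rightarrow> ('i \<Rightarrow> real) \<Rightarrow> real \<Rightarrow> real" where
  "count_le A q t = (\<Sum>m\<in>A. of_bool (q m \<le> t))"

text \<open>This is the numerator of \<open>M0_hat\<close>; the factor \<open>1 / (1 - l)\<close> is
  absorbed into the constant \<open>c\<close> below. It becomes a denominator once the feasibility
  inequality is solved for the level.\<close>

definition storey_denom :: "'i set \<Rightarrow> real \<Rightarrow> ('i \<Rightarrow> real) \<Rightarrow> real" where
  "storey_denom I l q = real (card I) - count_le I q l + 1"

text \<open>For nonnegative \<open>l\<close> and \<open>c\<close>: the largest level
  \<open>t\<close> in \<open>[0, l]\<close> with \<open>storey_denom I l q * t \<le> c * k\<close>,
  that is, feasible if there were \<open>k\<close> rejections.\<close>

definition step_threshold :: "'i set \<Rightarrow> real \<Rightarrow> real \<Rightarrow> ('i \<Rightarrow> real) \<Rightarrow> nat \<Rightarrow> real" where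
  "step_threshold I l c q k = min l (c * real k / storey_denom I l q)"

text \<open>This is \<open>t_hat\<close> for \<open>c = a * (1 - l)\<close>, see \<open>step_up_eq_Sup\<close>. A maximum over finitely many
  candidates is evidently measurable, and the supremum is attained.\<close>

definition step_up :: "'i set \<Rightarrow> real \<Rightarrow> real \<Rightarrow> ('i \<Rightarrow> real) \<Rightarrow> real" where
  "step_up I l c q =
     Max ((\<lambda>k. if real k \<le> max (count_le I q (step_threshold I l c q k)) 1
               then step_threshold I l c q k else 0) ` {1..card I})"

lemma count_le_nonneg: "0 \<le> count_le A q t"
  unfolding count_le_def by (simp add: sum_nonneg)

lemma count_le_mono: "s \<le> t \<Longrightarrow> count_le A q s \<le> count_le A q t"
  unfolding count_le_def by (intro sum_mono) (auto simp: of_bool_def)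

lemma count_le_le_card: "count_le A q t \<le> real (card A)"
  unfolding count_le_def using sum_bounded_above[of A "\<lambda>m. of_bool (q m \<le> t)" "1::real"] by simp

lemma count_le_subset: "finite B \<Longrightarrow> A \<subseteq> B \<Longrightarrow> count_le A q t \<le> count_le B q t"
  unfolding count_le_def by (intro sum_mono2) auto

lemma count_le_eq_card: "finite A \<Longrightarrow> count_le A q t = real (card {m\<in>A. q m \<le> t})"
  unfolding count_le_def by (simp add: of_bool_def sum.If_cases Int_def)

text \<open>The level \<open>f\<close> may depend on \<open>q\<close>, since counts are evaluated at
  data-dependent thresholds.\<close>

lemma count_le_measurable [measurable]:
  assumes "A \<subseteq> I" and [measurable]: "f \<in> borel_measurable (PiM I (\<lambda>_. borel))"
  shows "(\<lambda>q. count_le A q (f q)) \<in> borel_measurable (PiM I (\<lambda>_. borel))"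
  unfolding count_le_def
proof (rule borel_measurable_sum)
  fix m assume "m \<in> A"
  with assms(1) have m: "m \<in> I" by auto
  then have [measurable]: "(\<lambda>q. q m) \<in> borel_measurable (PiM I (\<lambda>_. borel :: real measure))"
    by (rule measurable_component_singleton)
  have "{q \<in> space (PiM I (\<lambda>_. borel)). q m \<le> f q} \<in> sets (PiM I (\<lambda>_. borel :: real measure))"
    by (rule borel_measurable_le) fact+
  then have "Measurable.pred (PiM I (\<lambda>_. borel)) (\<lambda>q. q m \<le> f q)"
    by (simp add: pred_def)
  then show "(\<lambda>q. of_bool (q m \<le> f q) :: real) \<in> borel_measurable (PiM I (\<lambda>_. borel))"
    by measurable
qed

text \<open>The moved coordinate is newly counted at \<open>l\<close>. This extra unit cancels the 1
  added in Storey's estimator.\<close>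

lemma count_le_fun_upd_0:
  assumes "finite I" "m \<in> I" "l < q m" "0 \<le> l"
  shows "count_le I (q(m := 0)) l = count_le I q l + 1"
proof -
  have split: "count_le I p l = of_bool (p m \<le> l) + count_le (I - {m}) p l" for p
    unfolding count_le_def using assms(1,2) by (rule sum.remove)
  have "count_le (I - {m}) (q(m := 0)) l = count_le (I - {m}) q l"
    unfolding count_le_def by (intro sum.cong) auto
  then show ?thesis
    using assms split[of q] split[of "q(m := 0)"] by simp
qed

lemma storey_denom_ge_1: "1 \<le> storey_denom I l q"
  unfolding storey_denom_def using count_le_le_card[of I q l] by simp

lemma storey_denom_measurable [measurable]:
  "storey_denom I l \<in> borel_measurable (PiM I (\<lambda>_. borel))"
proof -
  have [measurable]: "(\<lambda>q. count_le I q l) \<in> borel_measurable (PiM I (\<lambda>_. borel))"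
    by (intro count_le_measurable) auto
  show ?thesis unfolding storey_denom_def[abs_def] by measurable
qed

lemma step_up_measurable [measurable]:
  "step_up I l c \<in> borel_measurable (PiM I (\<lambda>_. borel))"
proof -
  have [measurable]: "(\<lambda>q. step_threshold I l c q k) \<in> borel_measurable (PiM I (\<lambda>_. borel))" for k
    unfolding step_threshold_def by measurable
  have [measurable]: "(\<lambda>q. count_le I q (step_threshold I l c q k))
      \<in> borel_measurable (PiM I (\<lambda>_. borel))" for k
    by (intro count_le_measurable) auto
  show ?thesis unfolding step_up_def[abs_def]
    by (intro borel_measurable_Max) auto
qed

context
  fixes I :: "'i set" and l c :: real and q :: "'i \<Rightarrow> real"
  assumes I: "finite I" "I \<noteq> {}" and l: "0 \<le> l" and c: "0 \<le> c"
begin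

lemma step_threshold_bounds: "0 \<le> step_threshold I l c q k" "step_threshold I l c q k \<le> l"
  unfolding step_threshold_def using l c storey_denom_ge_1[of I l q] by auto

lemma step_threshold_feasible:
  "storey_denom I l q * step_threshold I l c q k \<le> c * real k"
proof -
  have "step_threshold I l c q k \<le> c * real k / storey_denom I l q"
    unfolding step_threshold_def by simp
  with storey_denom_ge_1[of I l q] show ?thesis by (simp add: field_simps)
qed

text \<open>The maximum is attained. If the chosen \<open>k\<close> passes its test, replacing
  \<open>k\<close> by the count at its threshold, floored at 1, only relaxes the inequality; the
  default 0 is trivially feasible.\<close>

lemma step_up_feasible:
  "0 \<le> step_up I l c q" "step_up I l c q \<le> l"
  "storey_denom I l q * step_up I l c q \<le> c * max (count_le I q (step_up I l c q)) 1"
proof -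
  let ?S = "(\<lambda>k. if real k \<le> max (count_le I q (step_threshold I l c q k)) 1
               then step_threshold I l c q k else 0) ` {1..card I}"
  have "1 \<in> {1..card I}" using I by (simp add: Suc_le_eq card_gt_0_iff)
  then have "?S \<noteq> {}" by blast
  then have "step_up I l c q \<in> ?S" unfolding step_up_def by (intro Max_in) auto
  then obtain k where k: "step_up I l c q =
      (if real k \<le> max (count_le I q (step_threshold I l c q k)) 1 then step_threshold I l c q k else 0)"
    by blast
  show "0 \<le> step_up I l c q" "step_up I l c q \<le> l"
    unfolding k using step_threshold_bounds[of k] l by auto
  show "storey_denom I l q * step_up I l c q \<le> c * max (count_le I q (step_up I l c q)) 1"
  proof (cases "real k \<le> max (count_le I q (step_threshold I l c q k)) 1")
    case True
    then have e: "step_up I l c q = step_threshold I l c q k" using k by simp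
    have "storey_denom I l q * step_threshold I l c q k \<le> c * real k"
      by (rule step_threshold_feasible)
    also have "\<dots> \<le> c * max (count_le I q (step_threshold I l c q k)) 1"
      using True c by (rule mult_left_mono)
    finally show ?thesis unfolding e .
  next
    case False
    then have "step_up I l c q = 0" using k by simp
    then show ?thesis using c by simp
  qed
qed

text \<open>Take for \<open>k\<close> the count at \<open>t\<close>, floored at 1. Then
  \<open>t\<close> lies below the candidate for \<open>k\<close>, and since counts grow with the
  level, that candidate passes its test.\<close>

lemma step_up_greatest:
  assumes t: "0 \<le> t" "t \<le> l" "storey_denom I l q * t \<le> c * max (count_le I q t) 1"
  shows "t \<le> step_up I l c q"
proof -
  define k where "k = max (card {m\<in>I. q m \<le> t}) 1"
  have k: "real k = max (count_le I q t) 1"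
    unfolding k_def count_le_eq_card[OF I(1)] by simp
  have "card {m\<in>I. q m \<le> t} \<le> card I" using I by (intro card_mono) auto
  then have kI: "k \<in> {1..card I}" using I by (auto simp: k_def Suc_le_eq card_gt_0_iff)
  have "t \<le> step_threshold I l c q k"
    using t storey_denom_ge_1[of I l q] by (simp add: step_threshold_def k field_simps)
  moreover from this have "real k \<le> max (count_le I q (step_threshold I l c q k)) 1"
    using count_le_mono[of t "step_threshold I l c q k" I q] k by linarith
  ultimately show ?thesis
    unfolding step_up_def using kI by (subst Max_ge_iff) auto
qed

lemma step_up_eq_Sup:
  "Sup {t. 0 \<le> t \<and> t \<le> l \<and> storey_denom I l q * t \<le> c * max (count_le I q t) 1} = step_up I l c q"
  using step_up_feasible step_up_greatest by (intro cSup_eq_maximum) auto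

end

text \<open>Moving a coordinate below the threshold to 0 leaves the counts at all levels
  above that coordinate unchanged, and both suprema are attained at such levels.\<close>

lemma step_up_leave_one_out:
  fixes q :: "'i \<Rightarrow> real"
  assumes I: "finite I" "I \<noteq> {}" and l: "0 \<le> l" and c: "0 \<le> c"
    and q: "q m \<le> step_up I l c q"
  shows "step_up I l c (q(m := 0)) = step_up I l c q"
    and "count_le I (q(m := 0)) (step_up I l c q) = count_le I q (step_up I l c q)"
proof -
  let ?q = "q(m := 0)"
  note f = step_up_feasible[OF I l c] and g = step_up_greatest[OF I l c]
  have eq: "count_le I ?q t = count_le I q t" if "0 \<le> t" "q m \<le> t" for t
    unfolding count_le_def using that by (intro sum.cong) auto
  show "count_le I ?q (step_up I l c q) = count_le I q (step_up I l c q)"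
    using eq f(1) q by blast
  \<comment> \<open>Coordinate \<open>m\<close> was already counted at \<open>l\<close>, because
    \<open>q m\<close> is at most the threshold and hence at most \<open>l\<close>.\<close>
  have d: "storey_denom I l ?q = storey_denom I l q"
    unfolding storey_denom_def using eq[of l] l q f(2)[of q] by simp
  have 1: "step_up I l c q \<le> step_up I l c ?q"
    using f[of q] q by - (rule g, simp_all add: d eq)
  \<comment> \<open>By the first inequality the new threshold also lies above \<open>q m\<close>, so
    the counts agree there and it is feasible for \<open>q\<close>.\<close>
  then have "step_up I l c ?q \<le> step_up I l c q"
    using f[of ?q] q eq[of "step_up I l c ?q"] by - (rule g, simp_all add: d)
  with 1 show "step_up I l c ?q = step_up I l c q" by simp
qed

section \<open>Independence of pairs\<close>

context prob_space
begin

text \<open>The constant \<open>indep_var\<close> of the library forces both variables to have the same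
  type; this is independence without that restriction.\<close>

definition indep_pair where
  "indep_pair S X T Y \<longleftrightarrow> X \<in> measurable M S \<and> Y \<in> measurable M T \<and>
     distr M S X \<Otimes>\<^sub>M distr M T Y = distr M (S \<Otimes>\<^sub>M T) (\<lambda>\<omega>. (X \<omega>, Y \<omega>))"

lemma indep_pair_if_indep_var: "indep_var S X T Y \<Longrightarrow> indep_pair S X T Y"
  by (simp add: indep_pair_def indep_var_distribution_eq)

lemma indep_pair_compose:
  assumes "indep_pair S X T Y" and [measurable]: "f \<in> measurable S S'" "g \<in> measurable T T'"
  shows "indep_pair S' (\<lambda>\<omega>. f (X \<omega>)) T' (\<lambda>\<omega>. g (Y \<omega>))"
proof -
  have [measurable]: "X \<in> measurable M S" "Y \<in> measurable M T"
    and eq: "distr M S X \<Otimes>\<^sub>M distr M T Y = distr M (S \<Otimes>\<^sub>M T) (\<lambda>\<omega>. (X \<omega>, Y \<omega>))"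
    using assms(1) by (auto simp: indep_pair_def)
  have "prob_space (distr M T' (\<lambda>\<omega>. g (Y \<omega>)))" by (rule prob_space_distr) simp
  then have "sigma_finite_measure (distr (distr M T Y) T' g)"
    by (simp add: distr_distr comp_def prob_space_imp_sigma_finite)
  then have "distr (distr M S X) S' f \<Otimes>\<^sub>M distr (distr M T Y) T' g
      = distr (distr M S X \<Otimes>\<^sub>M distr M T Y) (S' \<Otimes>\<^sub>M T') (\<lambda>(x, y). (f x, g y))"
    by (intro pair_measure_distr) simp_all
  then show ?thesis
    unfolding eq by (simp add: indep_pair_def distr_distr comp_def)
qed

text \<open>The law of the triple is the product of its three marginals, and Tonelli rebrackets this
  product. It serves to separate one true null from the other true nulls taken together with the
  false ones.\<close>

lemma indep_pair_assoc:
  assumes AB: "indep_pair S A T B"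
    and ABC: "indep_pair (S \<Otimes>\<^sub>M T) (\<lambda>\<omega>. (A \<omega>, B \<omega>)) U C"
  shows "indep_pair S A (T \<Otimes>\<^sub>M U) (\<lambda>\<omega>. (B \<omega>, C \<omega>))"
proof -
  have [measurable]: "A \<in> measurable M S" "B \<in> measurable M T" "C \<in> measurable M U"
    using AB ABC by (auto simp: indep_pair_def)
  interpret DA: prob_space "distr M S A" by (rule prob_space_distr) simp
  interpret DB: prob_space "distr M T B" by (rule prob_space_distr) simp
  interpret DC: prob_space "distr M U C" by (rule prob_space_distr) simp
  have AB': "distr M S A \<Otimes>\<^sub>M distr M T B = distr M (S \<Otimes>\<^sub>M T) (\<lambda>x. (A x, B x))"
    using AB by (simp add: indep_pair_def)
  have ABC': "distr M (S \<Otimes>\<^sub>M T) (\<lambda>x. (A x, B x)) \<Otimes>\<^sub>M distr M U C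
      = distr M ((S \<Otimes>\<^sub>M T) \<Otimes>\<^sub>M U) (\<lambda>x. ((A x, B x), C x))"
    using ABC by (simp add: indep_pair_def)
  have BC: "indep_pair T B U C"
    using indep_pair_compose[OF ABC, of snd T "\<lambda>x. x" U] by simp
  then have BC': "distr M T B \<Otimes>\<^sub>M distr M U C = distr M (T \<Otimes>\<^sub>M U) (\<lambda>x. (B x, C x))"
    by (simp add: indep_pair_def)
  have "distr M S A \<Otimes>\<^sub>M distr M (T \<Otimes>\<^sub>M U) (\<lambda>x. (B x, C x))
      = distr M (S \<Otimes>\<^sub>M (T \<Otimes>\<^sub>M U)) (\<lambda>x. (A x, B x, C x))"
  proof (rule pair_measure_eqI)
    show "sigma_finite_measure (distr M S A)" ..
    have "prob_space (distr M (T \<Otimes>\<^sub>M U) (\<lambda>x. (B x, C x)))" by (rule prob_space_distr) simp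
    then show "sigma_finite_measure (distr M (T \<Otimes>\<^sub>M U) (\<lambda>x. (B x, C x)))"
      by (rule prob_space_imp_sigma_finite)
    fix X Y assume "X \<in> sets (distr M S A)" "Y \<in> sets (distr M (T \<Otimes>\<^sub>M U) (\<lambda>x. (B x, C x)))"
    then have [measurable]: "X \<in> sets S" "Y \<in> sets (T \<Otimes>\<^sub>M U)" by simp_all
    let ?A = "distr M S A" and ?B = "distr M T B" and ?C = "distr M U C"
    let ?J = "distr M ((S \<Otimes>\<^sub>M T) \<Otimes>\<^sub>M U) (\<lambda>x. ((A x, B x), C x))"
    have "emeasure (distr M (S \<Otimes>\<^sub>M (T \<Otimes>\<^sub>M U)) (\<lambda>x. (A x, B x, C x))) (X \<times> Y)
        = (\<integral>\<^sup>+ \<omega>. indicator X (A \<omega>) * indicator Y (B \<omega>, C \<omega>) \<partial>M)"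
      by (subst nn_integral_indicator[symmetric], simp, subst nn_integral_distr)
         (auto intro!: nn_integral_cong simp: indicator_times)
    also have "\<dots> = (\<integral>\<^sup>+ p. indicator X (fst (fst p)) * indicator Y (snd (fst p), snd p) \<partial>?J)"
      by (subst nn_integral_distr) simp_all
    \<comment> \<open>Both independence hypotheses enter here: the joint law becomes a threefold
      product.\<close>
    also have "\<dots> = (\<integral>\<^sup>+ p. indicator X (fst (fst p)) * indicator Y (snd (fst p), snd p) \<partial>((?A \<Otimes>\<^sub>M ?B) \<Otimes>\<^sub>M ?C))"
      unfolding AB' ABC' ..
    also have "\<dots> = (\<integral>\<^sup>+ p. \<integral>\<^sup>+ z. indicator X (fst p) * indicator Y (snd p, z) \<partial>?C \<partial>(?A \<Otimes>\<^sub>M ?B))"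
      by (subst DC.nn_integral_fst[symmetric]) simp_all
    also have "\<dots> = (\<integral>\<^sup>+ x. \<integral>\<^sup>+ y. \<integral>\<^sup>+ z. indicator X x * indicator Y (y, z) \<partial>?C \<partial>?B \<partial>?A)"
      by (subst DB.nn_integral_fst[symmetric]) simp_all
    also have "\<dots> = (\<integral>\<^sup>+ x. indicator X x * (\<integral>\<^sup>+ y. \<integral>\<^sup>+ z. indicator Y (y, z) \<partial>?C \<partial>?B) \<partial>?A)"
      by (intro nn_integral_cong) (simp split: split_indicator)
    also have "\<dots> = emeasure ?A X * (\<integral>\<^sup>+ p. indicator Y p \<partial>(?B \<Otimes>\<^sub>M ?C))"
      by (simp add: nn_integral_multc DC.nn_integral_fst)
    also have "\<dots> = emeasure ?A X * emeasure (distr M (T \<Otimes>\<^sub>M U) (\<lambda>x. (B x, C x))) Y"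
      by (simp add: BC')
    finally show "emeasure ?A X * emeasure (distr M (T \<Otimes>\<^sub>M U) (\<lambda>x. (B x, C x))) Y
      = emeasure (distr M (S \<Otimes>\<^sub>M (T \<Otimes>\<^sub>M U)) (\<lambda>x. (A x, B x, C x))) (X \<times> Y)" by simp
  qed simp
  then show ?thesis by (simp add: indep_pair_def)
qed

text \<open>By Fubini, \<open>X\<close> may be integrated out with \<open>Y\<close> fixed, where the
  threshold is constant. \<open>F\<close> has to be the distribution function of \<open>X\<close>
  only at values of \<open>T\<close>, so null distributions known on \<open>[0, l]\<close>
  suffice.\<close>

lemma expectation_indep_threshold:
  fixes X :: "'a \<Rightarrow> real" and T h :: "'b \<Rightarrow> real"
  assumes indep: "indep_pair borel X S Y"
    and [measurable]: "T \<in> borel_measurable S" "h \<in> borel_measurable S"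
    and h: "\<And>y. \<bar>h y\<bar> \<le> B"
    and [measurable]: "F \<in> borel_measurable borel"
    and X: "\<And>y. prob {\<omega>\<in>space M. X \<omega> \<le> T y} = F (T y)"
  shows "expectation (\<lambda>\<omega>. of_bool (X \<omega> \<le> T (Y \<omega>)) * h (Y \<omega>))
       = expectation (\<lambda>\<omega>. F (T (Y \<omega>)) * h (Y \<omega>))"
proof -
  have [measurable]: "X \<in> borel_measurable M" "Y \<in> measurable M S"
    using indep by (auto simp: indep_pair_def)
  interpret DX: prob_space "distr M borel X" by (rule prob_space_distr) simp
  interpret DY: prob_space "distr M S Y" by (rule prob_space_distr) simp
  interpret XY: pair_prob_space "distr M borel X" "distr M S Y" ..
  let ?f = "\<lambda>(x, y). of_bool (x \<le> T y) * h y"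
  have meas: "?f \<in> borel_measurable (borel \<Otimes>\<^sub>M S)" by measurable
  have int: "integrable (distr M borel X \<Otimes>\<^sub>M distr M S Y) ?f"
  proof (rule XY.P.integrable_const_bound)
    have "norm (?f x) \<le> B" for x
      using h[of "snd x"] by (auto simp: of_bool_def split_beta intro: order_trans[OF abs_ge_zero])
    then show "AE x in distr M borel X \<Otimes>\<^sub>M distr M S Y. norm (?f x) \<le> B" by blast
  qed (use meas in simp)
  have "expectation (\<lambda>\<omega>. of_bool (X \<omega> \<le> T (Y \<omega>)) * h (Y \<omega>))
      = (\<integral>p. ?f p \<partial>distr M (borel \<Otimes>\<^sub>M S) (\<lambda>\<omega>. (X \<omega>, Y \<omega>)))"
    by (subst integral_distr) (use meas in simp_all)
  also have "\<dots> = (\<integral>p. ?f p \<partial>(distr M borel X \<Otimes>\<^sub>M distr M S Y))"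
    using indep by (simp add: indep_pair_def)
  also have "\<dots> = (\<integral>y. (\<integral>x. of_bool (x \<le> T y) * h y \<partial>distr M borel X) \<partial>distr M S Y)"
    using int by (rule XY.integral_snd[symmetric])
  also have "\<dots> = (\<integral>y. F (T y) * h y \<partial>distr M S Y)"
  proof (rule Bochner_Integration.integral_cong[OF refl])
    fix y
    have "(\<integral>x. of_bool (x \<le> T y) \<partial>distr M borel X) = (\<integral>x. indicator {..T y} x \<partial>distr M borel X)"
      by (intro Bochner_Integration.integral_cong) (auto simp: indicator_def)
    also have "\<dots> = measure M (X -` {..T y} \<inter> space M)"
      by (simp add: measure_distr)
    also have "X -` {..T y} \<inter> space M = {\<omega>\<in>space M. X \<omega> \<le> T y}" by auto
    finally show "(\<integral>x. of_bool (x \<le> T y) * h y \<partial>distr M borel X) = F (T y) * h y"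
      using X[of y] by simp
  qed
  also have "\<dots> = expectation (\<lambda>\<omega>. F (T (Y \<omega>)) * h (Y \<omega>))"
    by (rule integral_distr) simp_all
  finally show ?thesis .
qed

section \<open>The bound for weighted p-values\<close>

text \<open>The FDP is the sum of the contributions \<open>R m\<close> of the true nulls. The weight
  condition allows the mean of \<open>R m\<close> to be charged to \<open>a\<close> times the mean
  of \<open>K m\<close>, and the \<open>K m\<close> sum to at most 1.\<close>

lemma expectation_fdp_le:
  fixes I T :: "'i set" and Q :: "'i \<Rightarrow> 'a \<Rightarrow> real" and w :: "'i \<Rightarrow> real" and l c a :: real
  defines "q \<equiv> \<lambda>\<omega>. \<lambda>j\<in>I. Q j \<omega>"
  assumes I: "finite I" and T: "T \<subseteq> I" "T \<noteq> {}"
    and l: "0 \<le> l" and c: "0 \<le> c" and a: "0 \<le> a"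
    and Q: "\<And>j. j \<in> I \<Longrightarrow> Q j \<in> borel_measurable M"
    and indep: "\<And>m. m \<in> T \<Longrightarrow>
      indep_pair borel (Q m) (PiM (I - {m}) (\<lambda>_. borel)) (\<lambda>\<omega>. \<lambda>j\<in>I - {m}. Q j \<omega>)"
    and unif: "\<And>m t. m \<in> T \<Longrightarrow> 0 \<le> t \<Longrightarrow> t \<le> l \<Longrightarrow> prob {\<omega>\<in>space M. Q m \<omega> \<le> t} = w m * t"
    and w: "\<And>m. m \<in> T \<Longrightarrow> 0 \<le> w m" "\<And>m. m \<in> T \<Longrightarrow> w m * c \<le> a * (1 - w m * l)"
  shows "expectation (\<lambda>\<omega>. count_le T (q \<omega>) (step_up I l c (q \<omega>)) /
           max (count_le I (q \<omega>) (step_up I l c (q \<omega>))) 1) \<le> a"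
proof -
  have Ine: "I \<noteq> {}" using T by auto
  let ?P = "\<lambda>A. PiM A (\<lambda>_. borel :: real measure)"
  have q_meas [measurable]: "q \<in> measurable M (?P I)"
    unfolding q_def using Q by (intro measurable_restrict) auto
  define cnt where "cnt q = count_le I q (step_up I l c q)" for q
  have cnt_meas [measurable]: "cnt \<in> borel_measurable (?P I)"
    unfolding cnt_def[abs_def] by (intro count_le_measurable) auto
  define R where "R m \<omega> = of_bool (Q m \<omega> \<le> step_up I l c (q \<omega>)) / max (cnt (q \<omega>)) 1" for m \<omega>
  \<comment> \<open>With coordinate \<open>m\<close> set to 0 the denominator is a function of the
    other coordinates, hence independent of \<open>Q m\<close>. If \<open>l < Q m\<close>, it equals
    the number of p-values above \<open>l\<close>.\<close>
  define K where "K m \<omega> = of_bool (l < Q m \<omega>) / storey_denom I l ((q \<omega>)(m := 0))" for m \<omega>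
  have R_meas: "R m \<in> borel_measurable M" if "m \<in> T" for m
  proof -
    have [measurable]: "Q m \<in> borel_measurable M" using that T Q by auto
    show ?thesis unfolding R_def[abs_def] by measurable
  qed
  have R_bound: "\<bar>R m \<omega>\<bar> \<le> 1" for m \<omega>
    unfolding R_def by (auto simp: of_bool_def divide_simps)
  have R_int: "integrable M (R m)" if "m \<in> T" for m
    using R_meas[OF that] R_bound by (intro integrable_const_bound[where B=1]) auto
  have upd_meas: "(\<lambda>y. y(m := 0)) \<in> measurable (?P (I - {m})) (?P I)" if "m \<in> I" for m
  proof -
    have "(\<lambda>y. y(m := 0)) \<in> measurable (?P (I - {m})) (?P (insert m (I - {m})))"
      by (rule measurable_fun_upd[where J="I - {m}" and f="\<lambda>y. y"]) auto
    then show ?thesis using that by (simp add: insert_absorb)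
  qed
  have key: "integrable M (K m)" "expectation (R m) \<le> a * expectation (K m)" if m: "m \<in> T" for m
  proof -
    have mI: "m \<in> I" using m T by auto
    note [measurable] = upd_meas[OF mI] Q[OF mI] R_meas[OF m]
    define Y where "Y \<omega> = (\<lambda>j\<in>I - {m}. Q j \<omega>)" for \<omega>
    have Y_meas [measurable]: "Y \<in> measurable M (?P (I - {m}))"
      unfolding Y_def using Q by (intro measurable_restrict) auto
    \<comment> \<open>\<open>Y\<close> is undefined at \<open>m\<close>, but the update overwrites
      this value.\<close>
    have Yq: "(Y \<omega>)(m := 0) = (q \<omega>)(m := 0)" for \<omega>
      unfolding Y_def q_def by auto
    \<comment> \<open>Leave-one-out versions of the threshold, of the reciprocal count at it and of
      the reciprocal Storey denominator, as functions of the other coordinates.\<close>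
    define t where "t y = step_up I l c (y(m := 0))" for y
    define h where "h y = 1 / max (cnt (y(m := 0))) 1" for y
    define k where "k y = 1 / storey_denom I l (y(m := 0))" for y
    have [measurable]: "t \<in> borel_measurable (?P (I - {m}))" "h \<in> borel_measurable (?P (I - {m}))"
       "k \<in> borel_measurable (?P (I - {m}))"
      unfolding t_def[abs_def] h_def[abs_def] k_def[abs_def] by measurable
    have t: "0 \<le> t y" "t y \<le> l" for y
      unfolding t_def using step_up_feasible[OF I Ine l c] by auto
    have h: "0 \<le> h y" "h y \<le> 1" for y
      unfolding h_def by (auto simp: divide_simps)
    have k: "0 \<le> k y" "k y \<le> 1" for y
      unfolding k_def using storey_denom_ge_1[of I l "y(m := 0)"] by (auto simp: divide_simps)
    \<comment> \<open>This is feasibility of the leave-one-out threshold, divided by both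
      denominators.\<close>
    have th: "t y * h y \<le> c * k y" for y
    proof -
      have "storey_denom I l (y(m := 0)) * t y \<le> c * max (cnt (y(m := 0))) 1"
        unfolding t_def cnt_def by (rule step_up_feasible[OF I Ine l c])
      then show ?thesis
        unfolding h_def k_def using storey_denom_ge_1[of I l "y(m := 0)"]
        by (simp add: field_simps)
    qed
    have ind: "indep_pair borel (Q m) (?P (I - {m})) Y"
      using indep[OF m] unfolding Y_def[abs_def] .
    have int: "integrable M (\<lambda>\<omega>. k (Y \<omega>))" "integrable M (\<lambda>\<omega>. of_bool (Q m \<omega> \<le> l) * k (Y \<omega>))"
      "integrable M (\<lambda>\<omega>. of_bool (Q m \<omega> \<le> t (Y \<omega>)) * h (Y \<omega>))"
      using h k by (auto intro!: integrable_const_bound[where B=1] simp: of_bool_def)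
    have int2: "integrable M (\<lambda>\<omega>. w m * t (Y \<omega>) * h (Y \<omega>))"
    proof (rule integrable_const_bound[where B="w m * l"])
      have "\<bar>w m * t (Y \<omega>) * h (Y \<omega>)\<bar> \<le> w m * l" for \<omega>
        using w(1)[OF m] h[of "Y \<omega>"] t[of "Y \<omega>"] mult_mono[of "t (Y \<omega>)" l "h (Y \<omega>)" 1] l
        by (simp add: abs_mult mult.assoc mult_left_mono)
      then show "AE \<omega> in M. norm (w m * t (Y \<omega>) * h (Y \<omega>)) \<le> w m * l" by simp
    qed simp
    \<comment> \<open>Writing the indicator of \<open>l < Q m\<close> as a complement makes the
      threshold lemma applicable with constant threshold \<open>l\<close>.\<close>
    have K: "K m \<omega> = k (Y \<omega>) - of_bool (Q m \<omega> \<le> l) * k (Y \<omega>)" for \<omega>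
      unfolding K_def k_def Yq by auto
    show "integrable M (K m)"
      unfolding K[abs_def] using int by auto
    have "expectation (\<lambda>\<omega>. of_bool (Q m \<omega> \<le> l) * k (Y \<omega>)) = expectation (\<lambda>\<omega>. w m * l * k (Y \<omega>))"
      using ind by (rule expectation_indep_threshold[where T="\<lambda>_. l" and B=1 and F="\<lambda>t. w m * t"])
        (use k l unif[OF m] in auto)
    then have EK: "expectation (K m) = (1 - w m * l) * expectation (\<lambda>\<omega>. k (Y \<omega>))"
      unfolding K[abs_def] using int by (simp add: algebra_simps)
    \<comment> \<open>If \<open>m\<close> is rejected, leaving it out changes neither threshold nor
      count; otherwise \<open>R m\<close> is 0 and the right side nonnegative.\<close>
    have "expectation (R m) \<le> expectation (\<lambda>\<omega>. of_bool (Q m \<omega> \<le> t (Y \<omega>)) * h (Y \<omega>))"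
    proof (rule integral_mono[OF R_int[OF m] int(3)])
      fix \<omega>
      show "R m \<omega> \<le> of_bool (Q m \<omega> \<le> t (Y \<omega>)) * h (Y \<omega>)"
      proof (cases "Q m \<omega> \<le> step_up I l c (q \<omega>)")
        case True
        then have "q \<omega> m \<le> step_up I l c (q \<omega>)" using mI by (simp add: q_def)
        from step_up_leave_one_out[OF I Ine l c this] True show ?thesis
          unfolding R_def t_def h_def cnt_def Yq by simp
      qed (use h in \<open>simp add: R_def\<close>)
    qed
    also have "\<dots> = expectation (\<lambda>\<omega>. w m * t (Y \<omega>) * h (Y \<omega>))"
      using ind by (rule expectation_indep_threshold[where B=1 and F="\<lambda>t. w m * t"])
        (use h t unif[OF m] in auto)
    also have "\<dots> \<le> expectation (\<lambda>\<omega>. a * (1 - w m * l) * k (Y \<omega>))"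
    proof (rule integral_mono[OF int2])
      fix \<omega>
      have "w m * t (Y \<omega>) * h (Y \<omega>) \<le> w m * c * k (Y \<omega>)"
        using mult_left_mono[OF th w(1)[OF m]] by (simp add: mult.assoc)
      also have "\<dots> \<le> a * (1 - w m * l) * k (Y \<omega>)"
        using w(2)[OF m] k(1) by (rule mult_right_mono)
      finally show "w m * t (Y \<omega>) * h (Y \<omega>) \<le> a * (1 - w m * l) * k (Y \<omega>)" .
    qed (use int in simp)
    also have "\<dots> = a * expectation (K m)" by (simp add: EK)
    finally show "expectation (R m) \<le> a * expectation (K m)" .
  qed
  have K_sum: "(\<Sum>m\<in>T. K m \<omega>) \<le> 1" for \<omega>
  proof -
    let ?D = "real (card I) - count_le I (q \<omega>) l"
    have Qq: "Q m \<omega> = q \<omega> m" if "m \<in> I" for m using that by (simp add: q_def)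
    have K: "K m \<omega> = of_bool (l < q \<omega> m) / ?D" if "m \<in> T" for m
    proof (cases "l < Q m \<omega>")
      case True
      with that T have "m \<in> I" "l < q \<omega> m" by (auto simp: Qq)
      then show ?thesis
        using True count_le_fun_upd_0[OF I _ _ l] by (simp add: K_def storey_denom_def)
    next
      case False
      with that T show ?thesis by (auto simp: K_def Qq)
    qed
    have "(\<Sum>m\<in>T. of_bool (l < q \<omega> m)) \<le> (\<Sum>m\<in>I. of_bool (l < q \<omega> m) :: real)"
      using I T by (intro sum_mono2) auto
    also have "\<dots> = (\<Sum>m\<in>I. 1 - of_bool (q \<omega> m \<le> l))"
      by (intro sum.cong) auto
    also have "\<dots> = ?D" by (simp add: sum_subtractf count_le_def)
    finally have "(\<Sum>m\<in>T. of_bool (l < q \<omega> m)) \<le> ?D" .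
    moreover have "0 \<le> ?D" using count_le_le_card[of I "q \<omega>" l] by simp
    moreover have "(\<Sum>m\<in>T. K m \<omega>) = (\<Sum>m\<in>T. of_bool (l < q \<omega> m)) / ?D"
      by (simp add: K sum_divide_distrib)
    \<comment> \<open>\<open>?D\<close> may be 0; the quotient is then 0 by convention.\<close>
    ultimately show ?thesis by (simp add: divide_le_eq_1) linarith
  qed
  have "expectation (\<lambda>\<omega>. count_le T (q \<omega>) (step_up I l c (q \<omega>)) /
           max (count_le I (q \<omega>) (step_up I l c (q \<omega>))) 1) = expectation (\<lambda>\<omega>. \<Sum>m\<in>T. R m \<omega>)"
  proof (rule Bochner_Integration.integral_cong[OF refl])
    fix \<omega>
    have "count_le T (q \<omega>) (step_up I l c (q \<omega>)) = (\<Sum>m\<in>T. of_bool (Q m \<omega> \<le> step_up I l c (q \<omega>)))"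
      unfolding count_le_def using T by (intro sum.cong) (auto simp: q_def)
    then show "count_le T (q \<omega>) (step_up I l c (q \<omega>)) /
        max (count_le I (q \<omega>) (step_up I l c (q \<omega>))) 1 = (\<Sum>m\<in>T. R m \<omega>)"
      by (simp add: R_def cnt_def sum_divide_distrib)
  qed
  also have "\<dots> = (\<Sum>m\<in>T. expectation (R m))"
    by (rule Bochner_Integration.integral_sum) (rule R_int)
  also have "\<dots> \<le> (\<Sum>m\<in>T. a * expectation (K m))"
    by (intro sum_mono key)
  also have "\<dots> = a * expectation (\<lambda>\<omega>. \<Sum>m\<in>T. K m \<omega>)"
    by (subst Bochner_Integration.integral_sum) (auto simp: key sum_distrib_left)
  also have "\<dots> \<le> a * 1"
  proof (rule mult_left_mono[OF _ a])
    have "expectation (\<lambda>\<omega>. \<Sum>m\<in>T. K m \<omega>) \<le> expectation (\<lambda>_. 1)"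
      using K_sum by (intro integral_mono) (auto intro: key)
    then show "expectation (\<lambda>\<omega>. \<Sum>m\<in>T. K m \<omega>) \<le> 1" by (simp add: prob_space)
  qed
  finally show ?thesis by simp
qed

section \<open>Independence of one true null from all other hypotheses\<close>

text \<open>The statistics form three blocks: \<open>m\<close> alone, the other true nulls and the
  false nulls. Reassociation makes the first independent of the other two jointly, and
  coordinatewise maps preserve this.\<close>

lemma indep_pair_one_rest:
  assumes indep: "indep_vars N Z T"
    and rest: "indep_var (PiM T N) (\<lambda>\<omega>. \<lambda>m\<in>T. Z m \<omega>) (PiM (I - T) N) (\<lambda>\<omega>. \<lambda>m\<in>I - T. Z m \<omega>)"
    and m: "m \<in> T" and T: "T \<subseteq> I"
    and f: "\<And>j. j \<in> I \<Longrightarrow> f j \<in> measurable (N j) L"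
  shows "indep_pair L (\<lambda>\<omega>. f m (Z m \<omega>)) (PiM (I - {m}) (\<lambda>_. L)) (\<lambda>\<omega>. \<lambda>j\<in>I - {m}. f j (Z j \<omega>))"
proof -
  define A where "A \<omega> = (\<lambda>j\<in>{m}. Z j \<omega>)" for \<omega>
  define B where "B \<omega> = (\<lambda>j\<in>T - {m}. Z j \<omega>)" for \<omega>
  define C where "C \<omega> = (\<lambda>j\<in>I - T. Z j \<omega>)" for \<omega>
  \<comment> \<open>Splits the vector of true nulls, so that \<open>rest\<close> becomes a statement
    about the pair of the first two blocks.\<close>
  let ?r = "\<lambda>x. (restrict x {m}, restrict x (T - {m}))"
  have r: "?r \<in> measurable (PiM T N) (PiM {m} N \<Otimes>\<^sub>M PiM (T - {m}) N)"
    using m by (intro measurable_Pair measurable_restrict_subset) auto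
  have AB: "indep_pair (PiM {m} N) A (PiM (T - {m}) N) B"
    unfolding A_def[abs_def] B_def[abs_def]
    using m by (intro indep_pair_if_indep_var indep_var_restrict[OF indep]) auto
  have "indep_pair (PiM {m} N \<Otimes>\<^sub>M PiM (T - {m}) N) (\<lambda>\<omega>. ?r (\<lambda>j\<in>T. Z j \<omega>)) (PiM (I - T) N) C"
    unfolding C_def[abs_def]
    by (rule indep_pair_compose[OF indep_pair_if_indep_var[OF rest] r, of "\<lambda>x. x"]) simp
  moreover have "?r (\<lambda>j\<in>T. Z j \<omega>) = (A \<omega>, B \<omega>)" for \<omega>
    using m by (auto simp: A_def B_def restrict_def)
  ultimately have "indep_pair (PiM {m} N \<Otimes>\<^sub>M PiM (T - {m}) N) (\<lambda>\<omega>. (A \<omega>, B \<omega>)) (PiM (I - T) N) C"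
    by simp
  from indep_pair_assoc[OF AB this]
  have ABC: "indep_pair (PiM {m} N) A (PiM (T - {m}) N \<Otimes>\<^sub>M PiM (I - T) N) (\<lambda>\<omega>. (B \<omega>, C \<omega>))" .
  \<comment> \<open>Reassembles the vector on \<open>I - {m}\<close> from the last two blocks while
    applying \<open>f\<close>.\<close>
  let ?g = "\<lambda>p. \<lambda>j\<in>I - {m}. f j (if j \<in> T then fst p j else snd p j)"
  have fm: "(\<lambda>x. f m (x m)) \<in> measurable (PiM {m} N) L"
    using f[of m] m T by (intro measurable_compose[OF measurable_component_singleton]) auto
  have g: "?g \<in> measurable (PiM (T - {m}) N \<Otimes>\<^sub>M PiM (I - T) N) (PiM (I - {m}) (\<lambda>_. L))"
  proof (rule measurable_restrict)
    fix j assume j: "j \<in> I - {m}"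
    show "(\<lambda>p. f j (if j \<in> T then fst p j else snd p j))
      \<in> measurable (PiM (T - {m}) N \<Otimes>\<^sub>M PiM (I - T) N) L"
    proof (cases "j \<in> T")
      case True
      then have "(\<lambda>p. fst p j) \<in> measurable (PiM (T - {m}) N \<Otimes>\<^sub>M PiM (I - T) N) (N j)"
        using j by (intro measurable_compose[OF measurable_fst measurable_component_singleton]) auto
      from measurable_compose[OF this f] True j show ?thesis by simp
    next
      case False
      then have "(\<lambda>p. snd p j) \<in> measurable (PiM (T - {m}) N \<Otimes>\<^sub>M PiM (I - T) N) (N j)"
        using j by (intro measurable_compose[OF measurable_snd measurable_component_singleton]) auto
      from measurable_compose[OF this f] False j show ?thesis by simp
    qed
  qed
  have "?g (B \<omega>, C \<omega>) = (\<lambda>j\<in>I - {m}. f j (Z j \<omega>))" for \<omega>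
    by (auto simp: B_def C_def)
  moreover have "f m (A \<omega> m) = f m (Z m \<omega>)" for \<omega>
    by (simp add: A_def)
  ultimately show ?thesis
    using indep_pair_compose[OF ABC fm g] by simp
qed

end

section \<open>Completion, and p-values of decision functions\<close>

text \<open>Preimages under \<open>f\<close> and \<open>g\<close> differ by a subset of a null set,
  which the completion measures. This covers the FDP at the threshold, whose paths are regular only
  almost surely.\<close>

lemma borel_measurable_completion_AE:
  assumes f: "f \<in> borel_measurable M" and ae: "AE x in M. f x = g x"
  shows "g \<in> borel_measurable (completion M)"
proof (rule measurableI)
  fix A :: "'b set" assume A: "A \<in> sets borel"
  show "g -` A \<inter> space (completion M) \<in> sets (completion M)"
  proof (rule completion.in_sets_AE)
    show "f -` A \<inter> space M \<in> sets (completion M)"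
      using f A by (intro sets_completionI_sets) (rule measurable_sets)
    show "AE x in completion M. x \<in> f -` A \<inter> space M \<longleftrightarrow> x \<in> g -` A \<inter> space (completion M)"
      using AE_completion[OF ae] by eventually_elim simp
  qed simp
qed simp

text \<open>The infimum ranges over rationals so that the p-value is measurable as a function of
  the test statistic even where the path is irregular.\<close>

definition p_value :: "(real \<Rightarrow> real) \<Rightarrow> real" where
  "p_value d = (INF r\<in>\<rat> \<inter> {0..1}. if d r = 1 then r else 1)"

lemma p_value_measurable:
  assumes "\<And>t. t \<in> {0..1} \<Longrightarrow> (\<lambda>z. d z t) \<in> borel_measurable N"
  shows "(\<lambda>z. p_value (d z)) \<in> borel_measurable N"
  unfolding p_value_def
proof (rule borel_measurable_cINF_real)
  show "countable (\<rat> \<inter> {0..1::real})" by (simp add: countable_rat)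
  fix r assume "r \<in> \<rat> \<inter> {0..1::real}"
  then have [measurable]: "(\<lambda>z. d z r) \<in> borel_measurable N" using assms by auto
  show "(\<lambda>z. if d z r = 1 then r else 1) \<in> borel_measurable N" by measurable
qed

text \<open>By monotonicity \<open>d\<close> is 1 at every point of \<open>[0, 1]\<close> above the
  infimum, and right continuity extends this to the infimum itself. Conversely, rationals approach
  \<open>t\<close> from above.\<close>

lemma p_value_le_iff:
  assumes mono: "mono_on {0..1} d" and rc: "\<And>t. t \<in> {0..<1} \<Longrightarrow> continuous (at_right t) d"
    and d1: "d 1 = 1" and d01: "\<And>t. t \<in> {0..1} \<Longrightarrow> d t \<in> {0, 1}" and t: "0 \<le> t" "t \<le> 1"
  shows "p_value d \<le> t \<longleftrightarrow> d t = 1"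
proof (cases "t = 1")
  case True
  \<comment> \<open>At \<open>r = 1\<close> both branches are 1, so the p-value never exceeds
    1.\<close>
  have "p_value d \<le> (if d 1 = 1 then 1 else 1)"
    unfolding p_value_def by (rule cINF_lower) (auto intro!: bdd_belowI[of _ 0])
  then show ?thesis using True d1 by simp
next
  case False
  with t have t1: "t < 1" by simp
  have bdd: "bdd_below ((\<lambda>r. if d r = 1 then r else 1) ` (\<rat> \<inter> {0..1}))"
    by (auto intro!: bdd_belowI[of _ 0])
  have up: "d s = 1" if "d r = 1" "0 \<le> r" "r \<le> s" "s \<le> 1" for r s
    using mono_onD[OF mono, of r s] d01[of s] that by auto
  show ?thesis
  proof
    assume p: "p_value d \<le> t"
    have "d s = 1" if s: "t < s" "s < 1" for s
    proof -
      have "p_value d < s" using p s by simp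
      moreover have "0 \<in> \<rat> \<inter> {0..1::real}" by simp
      then have ne: "\<rat> \<inter> {0..1::real} \<noteq> {}" by (metis empty_iff)
      \<comment> \<open>As \<open>s < 1\<close>, the default 1 cannot be the value found below
        \<open>s\<close>.\<close>
      ultimately have "\<exists>r\<in>\<rat> \<inter> {0..1}. (if d r = 1 then r else 1) < s"
        unfolding p_value_def cINF_less_iff[OF ne bdd] by simp
      then obtain r where r: "r \<in> \<rat> \<inter> {0..1}" "(if d r = 1 then r else 1) < s" ..
      then show ?thesis using s up[of r s] by (auto split: if_splits)
    qed
    then have "eventually (\<lambda>s. d s = 1) (at_right t)"
      using t1 unfolding eventually_at_right_field by blast
    then have "(d \<longlongrightarrow> 1) (at_right t)"
      by (rule tendsto_eventually)
    moreover have "(d \<longlongrightarrow> d t) (at_right t)"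
      using rc[of t] t t1 by (simp add: continuous_within)
    ultimately show "d t = 1"
      by (intro tendsto_unique[of "at_right t"]) auto
  next
    assume dt: "d t = 1"
    show "p_value d \<le> t"
    proof (rule dense_ge_bounded[OF t1])
      fix s assume s: "t < s" "s < 1"
      then obtain r where r: "r \<in> \<rat>" "t < r" "r < s" using Rats_dense_in_real by blast
      then have "p_value d \<le> (if d r = 1 then r else 1)"
        unfolding p_value_def using bdd t s by (intro cINF_lower) auto
      also have "\<dots> = r" using up[OF dt, of r] r s t by simp
      finally show "p_value d \<le> s" using r by simp
    qed
  qed
qed

text \<open>Multiplying \<open>FDP_hat M w d l t \<le> a\<close> by the positive number
  \<open>(1 - l) * max (count_le {1..M} q t) 1\<close> gives the feasibility inequality of
  \<open>step_up\<close> with \<open>c = a * (1 - l)\<close>.\<close>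

lemma FDP_t_hat_eq_step_up:
  assumes d: "\<And>m t. m \<in> {1..M} \<Longrightarrow> 0 \<le> t \<Longrightarrow> t \<le> l \<Longrightarrow> d m (t * w m) = of_bool (q m \<le> t)"
    and M: "1 \<le> M" and T: "T \<subseteq> {1..M}" and l: "0 \<le> l" "l < 1" and a: "0 \<le> a"
  defines "s \<equiv> step_up {1..M} l (a * (1 - l)) q"
  shows "FDP M T w d (t_hat M w d l l a) = count_le T q s / max (count_le {1..M} q s) 1"
proof -
  have c: "0 \<le> a * (1 - l)" and I: "finite {1..M}" "{1..M} \<noteq> {}" using a l M by auto
  have rej: "num_rej A w d t = count_le A q t" if "A \<subseteq> {1..M}" "0 \<le> t" "t \<le> l" for A t
    unfolding num_rej_def count_le_def using that d by (intro sum.cong) auto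
  have "FDP_hat M w d l t \<le> a \<longleftrightarrow>
      storey_denom {1..M} l q * t \<le> a * (1 - l) * max (count_le {1..M} q t) 1"
    if "0 \<le> t" "t \<le> l" for t
  proof -
    have "FDP_hat M w d l t = storey_denom {1..M} l q * t / ((1 - l) * max (count_le {1..M} q t) 1)"
      using l that by (simp add: FDP_hat_def M0_hat_def storey_denom_def rej)
    moreover have "0 < (1 - l) * max (count_le {1..M} q t) 1" using l by simp
    ultimately show ?thesis by (simp add: pos_divide_le_eq mult.assoc)
  qed
  then have "t_hat M w d l l a = Sup {t. 0 \<le> t \<and> t \<le> l \<and>
      storey_denom {1..M} l q * t \<le> a * (1 - l) * max (count_le {1..M} q t) 1}"
    unfolding t_hat_def by (intro arg_cong[where f=Sup]) auto
  also have "\<dots> = s"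
    unfolding s_def by (rule step_up_eq_Sup[OF I l(1) c])
  finally have "t_hat M w d l l a = s" .
  moreover have "0 \<le> s" "s \<le> l"
    unfolding s_def using step_up_feasible[OF I l(1) c] by auto
  ultimately show ?thesis
    using T by (simp add: FDP_def rej)
qed

section \<open>FDR control for the given decision functions\<close>

text \<open>Integrability is part of the conclusion because a non-integrable function has integral 0
  by convention, which would make the bound trivial.\<close>

theorem theorem3:
  fixes P :: "'a measure" and N :: "nat \<Rightarrow> 'z measure"
    and M :: nat and M0 :: "nat set"
    and Z :: "nat \<Rightarrow> 'a \<Rightarrow> 'z" and \<delta> :: "nat \<Rightarrow> 'z \<Rightarrow> real \<Rightarrow> real"
    and w :: "nat \<Rightarrow> real" and \<alpha> \<alpha>' lam u wmax :: real
  assumes "prob_space P"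
    and "\<And>m. m \<in> {1..M} \<Longrightarrow> Z m \<in> measurable P (N m)"
    and "M0 \<subseteq> {1..M}" and "card M0 \<ge> 1"
    and "decision_functions M N \<delta>"
    and "NS_assumptions P M M0 Z \<delta>"
    and "prob_space.indep_vars P N Z M0"
    and "prob_space.indep_var P
           (PiM M0 N) (\<lambda>\<omega>. \<lambda>m\<in>M0. Z m \<omega>)
           (PiM ({1..M} - M0) N) (\<lambda>\<omega>. \<lambda>m\<in>{1..M} - M0. Z m \<omega>)"
    and "\<And>m. m \<in> {1..M} \<Longrightarrow> w m > 0"
    and "(\<Sum>m\<in>{1..M}. w m) / real M = 1"
    and "wmax = Max (w ` {1..M})"
    and "0 < \<alpha>" and "\<alpha> < 1" and "0 < lam" and "lam < 1"
    and "u = lam" and "lam \<le> 1 / wmax"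
    and "\<alpha>' = \<alpha> * (1 / wmax) * ((1 - lam * wmax) / (1 - lam))"
  shows "integrable (completion P) (FDP_at_t_hat M M0 Z \<delta> w u lam \<alpha>') \<and>
         FDR P M M0 Z \<delta> w u lam \<alpha>' \<le> \<alpha>"
proof -
  interpret prob_space P by fact
  note Z_meas = assms(2) and w_pos = assms(9)
  let ?I = "{1..M}"
  define c where "c = \<alpha>' * (1 - lam)"
  have M0: "M0 \<subseteq> ?I" "M0 \<noteq> {}" using assms(3,4) by auto
  then have M: "1 \<le> M" by fastforce
  have w_le: "w m \<le> wmax" if "m \<in> ?I" for m
    unfolding assms(11) using that by (intro Max_ge) auto
  have wmax: "0 < wmax" using w_pos[of 1] w_le[of 1] M by simp
  have lw: "lam * wmax \<le> 1" using assms(17) wmax by (simp add: field_simps)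
  \<comment> \<open>Since \<open>lam * wmax \<le> 1\<close>, all arguments \<open>t * w m\<close>
    stay in the range where the decision functions are specified.\<close>
  have lwm: "0 \<le> t * w m" "t * w m \<le> 1" if "m \<in> ?I" "0 \<le> t" "t \<le> lam" for m t
    using w_pos[OF that(1)] w_le[OF that(1)] that lw mult_mono[of t lam "w m" wmax] wmax by auto
  have \<alpha>': "0 \<le> \<alpha>'" unfolding assms(18) using assms(12,15) wmax lw by simp
  have c: "c = \<alpha> * (1 / wmax) * (1 - lam * wmax)" "0 \<le> c"
    unfolding c_def using assms(15) \<alpha>' by (simp add: assms(18), simp)
  \<comment> \<open>The choice of \<open>\<alpha>'\<close> enters here:
    \<open>w m / wmax \<le> 1\<close> and \<open>1 - lam * wmax \<le> 1 - w m * lam\<close>.\<close>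
  have wc: "w m * c \<le> \<alpha> * (1 - w m * lam)" if m: "m \<in> ?I" for m
  proof -
    have "w m * c = (w m / wmax) * (\<alpha> * (1 - lam * wmax))" by (simp add: c)
    also have "\<dots> \<le> 1 * (\<alpha> * (1 - lam * wmax))"
      using w_le[OF m] wmax lw assms(12) by (intro mult_right_mono) auto
    also have "\<dots> \<le> \<alpha> * (1 - w m * lam)"
      using w_le[OF m] assms(12,14) by simp
    finally show ?thesis .
  qed
  define f where "f m z = p_value (\<delta> m z) / w m" for m z
  have f_meas: "f m \<in> borel_measurable (N m)" if "m \<in> ?I" for m
  proof -
    have "(\<lambda>z. p_value (\<delta> m z)) \<in> borel_measurable (N m)"
      using assms(5) that by (intro p_value_measurable) (auto simp: decision_functions_def)
    then show ?thesis unfolding f_def[abs_def] by measurable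
  qed
  define Q where "Q m \<omega> = f m (Z m \<omega>)" for m \<omega>
  have Q_meas: "Q m \<in> borel_measurable P" if "m \<in> ?I" for m
    unfolding Q_def[abs_def] using that Z_meas f_meas by (blast intro: measurable_compose)
  \<comment> \<open>One null set serves all \<open>t\<close> at once, because regularity concerns
    whole paths and there are finitely many of them.\<close>
  have good: "AE \<omega> in P. \<forall>m\<in>?I. \<forall>t. 0 \<le> t \<longrightarrow> t \<le> lam \<longrightarrow>
      \<delta> m (Z m \<omega>) (t * w m) = of_bool (Q m \<omega> \<le> t)"
  proof (rule AE_finite_allI)
    fix m assume m: "m \<in> ?I"
    from assms(6) m have "AE \<omega> in P. mono_on {0..1} (\<delta> m (Z m \<omega>)) \<and>
        (\<forall>t\<in>{0..<1}. continuous (at_right t) (\<delta> m (Z m \<omega>))) \<and>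
        \<delta> m (Z m \<omega>) 0 = 0 \<and> \<delta> m (Z m \<omega>) 1 = 1"
      unfolding NS_assumptions_def by blast
    with AE_space show "AE \<omega> in P. \<forall>t. 0 \<le> t \<longrightarrow> t \<le> lam \<longrightarrow>
      \<delta> m (Z m \<omega>) (t * w m) = of_bool (Q m \<omega> \<le> t)"
    proof eventually_elim
      case (elim \<omega>)
      have "Z m \<omega> \<in> space (N m)" using measurable_space[OF Z_meas[OF m]] elim by blast
      with assms(5) m have d01: "\<delta> m (Z m \<omega>) t \<in> {0, 1}" if "t \<in> {0..1}" for t
        using that unfolding decision_functions_def by blast
      show ?case
      proof (intro allI impI)
        fix t assume t: "0 \<le> t" "t \<le> lam"
        have "Q m \<omega> \<le> t \<longleftrightarrow> p_value (\<delta> m (Z m \<omega>)) \<le> t * w m"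
          using w_pos[OF m] by (simp add: Q_def f_def field_simps)
        also have "\<dots> \<longleftrightarrow> \<delta> m (Z m \<omega>) (t * w m) = 1"
          using elim lwm[OF m t] by (intro p_value_le_iff d01) auto
        finally show "\<delta> m (Z m \<omega>) (t * w m) = of_bool (Q m \<omega> \<le> t)"
          using d01[of "t * w m"] lwm[OF m t] by auto
      qed
    qed
  qed simp
  \<comment> \<open>Almost surely the decision at \<open>t * w m\<close> is the indicator of this
    event, and for a true null its mean is \<open>t * w m\<close>.\<close>
  have unif: "prob {\<omega>\<in>space P. Q m \<omega> \<le> t} = w m * t"
    if m: "m \<in> M0" and t: "0 \<le> t" "t \<le> lam" for m t
  proof -
    have mI: "m \<in> ?I" using m M0 by auto
    note [measurable] = Q_meas[OF mI]
    have [measurable]: "(\<lambda>\<omega>. \<delta> m (Z m \<omega>) (t * w m)) \<in> borel_measurable P"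
      using assms(5) mI lwm[OF mI t] unfolding decision_functions_def
      by (intro measurable_compose[OF Z_meas[OF mI]]) auto
    have "prob {\<omega>\<in>space P. Q m \<omega> \<le> t} = expectation (indicator {\<omega>\<in>space P. Q m \<omega> \<le> t})"
      by simp
    also have "\<dots> = expectation (\<lambda>\<omega>. \<delta> m (Z m \<omega>) (t * w m))"
    proof (rule integral_cong_AE)
      show "AE \<omega> in P. indicator {\<omega>\<in>space P. Q m \<omega> \<le> t} \<omega> = \<delta> m (Z m \<omega>) (t * w m)"
        using good AE_space by eventually_elim (use t mI in \<open>auto simp: indicator_def\<close>)
    qed simp_all
    also have "\<dots> = t * w m"
      using assms(6) m lwm[OF mI t] unfolding NS_assumptions_def by auto
    finally show ?thesis by simp
  qed
  have indep: "indep_pair borel (Q m) (PiM (?I - {m}) (\<lambda>_. borel)) (\<lambda>\<omega>. \<lambda>j\<in>?I - {m}. Q j \<omega>)"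
    if "m \<in> M0" for m
    using indep_pair_one_rest[OF assms(7,8) that M0(1) f_meas] unfolding Q_def .
  define q where "q \<omega> = (\<lambda>j\<in>?I. Q j \<omega>)" for \<omega>
  have [measurable]: "q \<in> measurable P (PiM ?I (\<lambda>_. borel))"
    unfolding q_def using Q_meas by (intro measurable_restrict) auto
  \<comment> \<open>A version of the FDP at the threshold that is measurable for \<open>P\<close>
    itself and agrees with it on the event \<open>good\<close>.\<close>
  define g where "g \<omega> = count_le M0 (q \<omega>) (step_up ?I lam c (q \<omega>)) /
      max (count_le ?I (q \<omega>) (step_up ?I lam c (q \<omega>))) 1" for \<omega>
  have [measurable]: "(\<lambda>x. count_le A x (step_up ?I lam c x)) \<in> borel_measurable (PiM ?I (\<lambda>_. borel))"
    if "A \<subseteq> ?I" for A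
    using that by (rule count_le_measurable) simp
  have g_meas: "g \<in> borel_measurable P"
    unfolding g_def[abs_def] using M0 by measurable
  have "x / max y 1 \<le> 1" if "x \<le> y" for x y :: real
    using that by (subst divide_le_eq_1_pos) auto
  then have "\<bar>g \<omega>\<bar> \<le> 1" for \<omega>
    using count_le_nonneg[of M0 "q \<omega>" "step_up ?I lam c (q \<omega>)"]
      count_le_subset[OF _ M0(1), of "q \<omega>" "step_up ?I lam c (q \<omega>)"]
    by (simp add: g_def)
  then have g_int: "integrable P g"
    using g_meas by (intro integrable_const_bound[where B=1]) auto
  have eq: "AE \<omega> in P. g \<omega> = FDP_at_t_hat M M0 Z \<delta> w u lam \<alpha>' \<omega>"
    using good
  proof eventually_elim
    case (elim \<omega>)
    then show ?case
      using assms(14,15) M M0(1) \<alpha>' unfolding FDP_at_t_hat_def Let_def assms(16) g_def c_def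
      by (intro FDP_t_hat_eq_step_up[symmetric]) (auto simp: q_def)
  qed
  have meas: "FDP_at_t_hat M M0 Z \<delta> w u lam \<alpha>' \<in> borel_measurable (completion P)"
    using g_meas eq by (rule borel_measurable_completion_AE)
  have g_meas': "g \<in> borel_measurable (completion P)"
    using g_meas by (rule measurable_completion)
  have "integrable (completion P) (FDP_at_t_hat M M0 Z \<delta> w u lam \<alpha>')"
    using g_int g_meas by (intro integrable_cong_AE_imp[OF _ meas AE_completion[OF eq]])
      (simp add: integrable_completion)
  moreover have "FDR P M M0 Z \<delta> w u lam \<alpha>' = integral\<^sup>L (completion P) g"
    unfolding FDR_def using AE_completion[OF eq]
    by (intro integral_cong_AE meas g_meas') (auto simp: eq_commute)
  moreover have "\<dots> = expectation g" using g_meas by (rule integral_completion)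
  moreover have "expectation g \<le> \<alpha>"
    unfolding g_def[abs_def] q_def
  proof (rule expectation_fdp_le[where w=w])
    show "0 \<le> w m" "w m * c \<le> \<alpha> * (1 - w m * lam)" if "m \<in> M0" for m
      using that M0 w_pos[of m] wc[of m] by auto
  qed (use assms(12,14) c M0 in \<open>simp_all add: Q_meas unif indep[simplified]\<close>)
  ultimately show ?thesis by simp
qed

end
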